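(* Let $r > s \ge 1$ be integers, and set $\varepsilon = (r-s)/r$. Then $$R_{r,s}(k) \ge \bigg( \frac{\varepsilon (k-1)}{e} \bigg)^{\varepsilon r/2}$$ for every $k \in \mathbb{N}$.
   Context: For positive integers $r > s \ge 1$ and $k$, the set-colouring Ramsey number $R_{r,s}(k)$ is the least $n \in \mathbb{N}$ such that every colouring $\chi \colon E(K_n) \to \binom{[r]}{s}$ (each edge of $K_n$ is assigned a set of exactly $s$ colours from $[r]$) contains a monochromatic clique of size $k$, i.e. a $k$-set $S$ of vertices and a colour $i$ with $i \in \chi(e)$ for all $e \in \binom{S}{2}$. Here $e$ denotes Euler's number. *)

theory Defs
  imports Complex_Main "HOL-Library.Ramsey"
begin

text \<open>
  A colouring of the edges of the complete graph on \<open>{..<n}\<close>: each edge, as a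
  two-element vertex set, gets a set of exactly \<open>s\<close> colours from \<open>{1..r}\<close>.
  Values of \<open>c\<close> outside the edge set are unconstrained and never used.
\<close>
definition set_colouring :: "nat \<Rightarrow> nat \<Rightarrow> nat \<Rightarrow> (nat set \<Rightarrow> nat set) \<Rightarrow> bool" where
  "set_colouring r s n c \<longleftrightarrow> c \<in> nsets {..<n} 2 \<rightarrow> nsets {1..r} s"

definition has_mono_clique :: "nat \<Rightarrow> nat \<Rightarrow> nat \<Rightarrow> (nat set \<Rightarrow> nat set) \<Rightarrow> bool" where
  "has_mono_clique r k n c \<longleftrightarrow>
     (\<exists>S \<in> nsets {..<n} k. \<exists>i \<in> {1..r}. \<forall>e \<in> nsets S 2. i \<in> c e)"

definition set_ramsey :: "nat \<Rightarrow> nat \<Rightarrow> nat \<Rightarrow> nat" where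
  "set_ramsey r s k =
     (LEAST n. \<forall>c. set_colouring r s n c \<longrightarrow> has_mono_clique r k n c)"

text \<open>The set whose minimum defines \<open>set_ramsey\<close> is nonempty, so \<open>LEAST\<close> is meaningful.\<close>
lemma set_ramsey_exists:
  assumes "1 \<le> s"
  shows "\<exists>n. \<forall>c. set_colouring r s n c \<longrightarrow> has_mono_clique r k n c"
proof -
  obtain N :: nat where N: "partn_lst {..<N} (replicate r k) 2"
    using ramsey_full by blast
  have "has_mono_clique r k N c" if col: "set_colouring r s N c" for c
  proof -
    define f where "f e = (SOME i. i \<in> c e) - 1" for e
    have f: "Suc (f e) \<in> c e \<and> f e < r" if "e \<in> nsets {..<N} 2" for e
    proof -
      have e: "c e \<subseteq> {1..r}" "card (c e) = s"
        using col that by (auto simp: set_colouring_def nsets_def Pi_iff)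
      then have "c e \<noteq> {}" using assms by auto
      then have "(SOME i. i \<in> c e) \<in> c e" by (simp add: some_in_eq)
      then show ?thesis using e(1) by (fastforce simp: f_def)
    qed
    then have "f \<in> nsets {..<N} 2 \<rightarrow> {..<r}" by auto
    then obtain i H where i: "i < r" and H: "H \<in> nsets {..<N} k" 
      and fH: "f ` nsets H 2 \<subseteq> {i}"
      using N unfolding partn_lst_def monochromatic_def by fastforce
    have "Suc i \<in> c e" if "e \<in> nsets H 2" for e
    proof -
      have "e \<in> nsets {..<N} 2" using that H by (auto simp: nsets_def)
      moreover have "f e = i" using fH that by auto
      ultimately show ?thesis using f by blast
    qed
    then show ?thesis
      unfolding has_mono_clique_def using H i
      by (intro bexI[of _ H] bexI[of _ "Suc i"]) auto
  qed
  then show ?thesis by blast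
qed

end

theory Submission
  imports Defs
begin

text \<open>
  Put \<open>q = k - 1\<close>. If any two words of a code in \<open>[q]\<^sup>r\<close> differ in at least \<open>s\<close> coordinates,
  give the edge between two words \<open>s\<close> coordinates in which they differ. In colour \<open>i\<close> the words
  of a monochromatic clique have distinct \<open>i\<close>-th letters, so there are at most \<open>q < k\<close> of them.
  With \<open>j = r - s + 1\<close>, at most \<open>binom(r,j) q\<^bsup>r-j\<^esup>\<close> words agree with a given one in at least
  \<open>j\<close> places, so the greedy (Gilbert-Varshamov) argument yields a code of size about
  \<open>q\<^sup>j / binom(r,j) \<ge> (j q / (e r))\<^sup>j\<close>.
  This exceeds the required bound if the base \<open>\<epsilon> (k - 1) / e\<close> is greater than \<open>1\<close>; otherwise the
  bound is at most \<open>1\<close> and zero vertices suffice.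
\<close>

text \<open>The term \<open>j ^ j / fact j\<close> of the exponential series at \<open>j\<close> is
  at most its sum \<open>exp j\<close>; combine this with
  \<open>(n choose j) * fact j \<le> n ^ j\<close>.\<close>

lemma binomial_le_exp_power:
  assumes "0 < j"
  shows "real (n choose j) \<le> (exp 1 * real n / real j) ^ j"
proof -
  have "real j ^ j / fact j \<le> exp (real j)"
  proof -
    have s: "(\<lambda>n. real j ^ n /\<^sub>R fact n) sums exp (real j)"
      by (rule exp_converges)
    have "(\<Sum>i\<in>{j}. real j ^ i /\<^sub>R fact i) \<le> (\<Sum>i. real j ^ i /\<^sub>R fact i)"
      using s by (intro sum_le_suminf) (auto simp: sums_iff)
    then show ?thesis
      using s by (simp add: sums_iff divide_inverse mult.commute)
  qed
  then have exp: "real j ^ j \<le> exp 1 ^ j * fact j"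
    by (simp add: field_simps flip: exp_of_nat_mult)
  have "real (n choose j) * real j ^ j \<le> real (n choose j) * (exp 1 ^ j * fact j)"
    using exp by (intro mult_left_mono) auto
  also have "\<dots> = exp 1 ^ j * real ((n choose j) * fact j)"
    by simp
  also have "\<dots> \<le> exp 1 ^ j * real (n ^ j)"
    using binomial_fact_pow[of n j] by (intro mult_left_mono of_nat_mono) auto
  finally show ?thesis
    using assms by (simp add: field_simps power_mult_distrib power_divide)
qed

text \<open>Extensional functions are determined by their \<open>r\<close> letters, which makes the
  set finite and counting exact.\<close>

definition words :: "nat \<Rightarrow> nat \<Rightarrow> (nat \<Rightarrow> nat) set" where
  "words q r = {1..r} \<rightarrow>\<^sub>E {..<q}"

definition agree :: "nat \<Rightarrow> (nat \<Rightarrow> nat) \<Rightarrow> (nat \<Rightarrow> nat) \<Rightarrow> nat set" where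
  "agree r u v = {i \<in> {1..r}. u i = v i}"

lemma agree_commute: "agree r u v = agree r v u"
  by (auto simp: agree_def)

lemma finite_words [simp]: "finite (words q r)"
  by (simp add: words_def finite_PiE)

lemma card_words [simp]: "card (words q r) = q ^ r"
  by (simp add: words_def card_PiE)

text \<open>Only the coordinates outside \<open>J\<close> remain free. Equality can fail because
  \<open>w\<close> is arbitrary: its letters on \<open>J\<close> may lie outside the
  alphabet.\<close>

lemma card_words_agreeing_on:
  assumes "J \<subseteq> {1..r}"
  shows "card {v \<in> words q r. \<forall>i\<in>J. v i = w i} \<le> q ^ (r - card J)"
proof -
  let ?P = "PiE {1..r} (\<lambda>i. if i \<in> J then {w i} else {..<q})"
  have "card {v \<in> words q r. \<forall>i\<in>J. v i = w i} \<le> card ?P"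
    by (intro card_mono finite_PiE) (auto simp: words_def PiE_def)
  also have "card ?P = (\<Prod>i\<in>{1..r}. if i \<in> J then 1 else q)"
    by (subst card_PiE) (auto intro!: prod.cong)
  also have "\<dots> = (\<Prod>i\<in>{1..r} - J. q)"
    by (rule prod.mono_neutral_cong_right) auto
  also have "\<dots> = q ^ (r - card J)"
    using assms by (simp add: card_Diff_subset finite_subset)
  finally show ?thesis .
qed

text \<open>Union bound over the \<open>j\<close>-subsets \<open>J\<close> of the coordinates: a
  word agreeing with \<open>w\<close> in at least \<open>j\<close> places agrees with it on all of
  some such \<open>J\<close>.\<close>

lemma card_words_agreeing:
  "card {v \<in> words q r. j \<le> card (agree r v w)} \<le> (r choose j) * q ^ (r - j)"
proof -
  let ?B = "\<lambda>J. {v \<in> words q r. \<forall>i\<in>J. v i = w i}"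
  have "{v \<in> words q r. j \<le> card (agree r v w)} \<subseteq> (\<Union>J\<in>nsets {1..r} j. ?B J)"
  proof
    fix v assume v: "v \<in> {v \<in> words q r. j \<le> card (agree r v w)}"
    then obtain J where "J \<subseteq> agree r v w" "card J = j" "finite J"
      using obtain_subset_with_card_n[of j "agree r v w"] by auto
    then have "J \<in> nsets {1..r} j" "v \<in> ?B J"
      using v by (auto simp: nsets_def agree_def)
    then show "v \<in> (\<Union>J\<in>nsets {1..r} j. ?B J)"
      by blast
  qed
  then have "card {v \<in> words q r. j \<le> card (agree r v w)}
      \<le> card (\<Union>J\<in>nsets {1..r} j. ?B J)"
    by (rule card_mono[rotated]) (auto simp: finite_imp_finite_nsets)
  also have "\<dots> \<le> (\<Sum>J\<in>nsets {1..r} j. card (?B J))"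
    by (rule card_UN_le) (simp add: finite_imp_finite_nsets)
  also have "\<dots> \<le> (\<Sum>J\<in>nsets {1..r} j. q ^ (r - j))"
    using card_words_agreeing_on by (intro sum_mono) (fastforce simp: nsets_def)
  also have "\<dots> = (r choose j) * q ^ (r - j)"
    by (simp add: card_nsets)
  finally show ?thesis .
qed

text \<open>Words are added one at a time. When \<open>m\<close> have been chosen, they exclude at
  most \<open>m * (r choose j) * q ^ (r - j)\<close> words, fewer than all \<open>q ^ r\<close>. The
  last choice is made with \<open>n - 1\<close> words present, hence \<open>m < n\<close>.\<close>

lemma greedy_code:
  assumes "j \<le> r" and "0 < q" and "\<forall>m<n. m * (r choose j) < q ^ j"
  shows "\<exists>f. (\<forall>u<n. f u \<in> words q r) \<and>
             (\<forall>u<n. \<forall>v<n. u \<noteq> v \<longrightarrow> card (agree r (f u) (f v)) < j)"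
  using assms(3)
proof (induction n)
  case (Suc n)
  then obtain f where f: "\<forall>u<n. f u \<in> words q r"
    "\<forall>u<n. \<forall>v<n. u \<noteq> v \<longrightarrow> card (agree r (f u) (f v)) < j"
    by (metis less_SucI)
  let ?bad = "\<Union>u\<in>{..<n}. {v \<in> words q r. j \<le> card (agree r v (f u))}"
  have "card ?bad \<le> (\<Sum>u\<in>{..<n}. card {v \<in> words q r. j \<le> card (agree r v (f u))})"
    by (rule card_UN_le) simp
  also have "\<dots> \<le> (\<Sum>u\<in>{..<n}. (r choose j) * q ^ (r - j))"
    by (intro sum_mono card_words_agreeing)
  also have "\<dots> = n * (r choose j) * q ^ (r - j)"
    by simp
  also have "\<dots> < q ^ j * q ^ (r - j)"
    using Suc.prems assms(2) by (intro mult_strict_right_mono) auto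
  also have "\<dots> = card (words q r)"
    using assms(1) by (simp flip: power_add)
  finally have "\<not> words q r \<subseteq> ?bad"
    using card_mono[of ?bad "words q r"] by auto
  then obtain w where w: "w \<in> words q r" "\<forall>u<n. card (agree r w (f u)) < j"
    by (force simp: not_le)
  show ?case
  proof (intro exI[of _ "f(n := w)"] conjI allI impI)
    fix u assume "u < Suc n"
    then show "(f(n := w)) u \<in> words q r"
      using f w by (auto simp: less_Suc_eq)
  next
    fix u v assume "u < Suc n" "v < Suc n" "u \<noteq> v"
    then show "card (agree r ((f(n := w)) u) ((f(n := w)) v)) < j"
      using f w by (auto simp: less_Suc_eq agree_commute[of r _ w])
  qed
qed simp

lemma colouring_of_code:
  assumes "s \<le> r" and "q < k"
    and words: "\<forall>u<n. f u \<in> words q r"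
    and sep: "\<forall>u<n. \<forall>v<n. u \<noteq> v \<longrightarrow> card (agree r (f u) (f v)) \<le> r - s"
  shows "\<exists>c. set_colouring r s n c \<and> \<not> has_mono_clique r k n c"
proof -
  \<comment> \<open>On an edge, injectivity means that the words of its two ends differ at
    \<open>i\<close>; this form does not require naming or ordering the ends.\<close>
  define D where "D e = {i \<in> {1..r}. inj_on (\<lambda>u. f u i) e}" for e
  have "\<exists>A. A \<in> nsets {1..r} s \<and> A \<subseteq> D e" if edge: "e \<in> nsets {..<n} 2" for e
  proof -
    obtain u v where e: "e = {u, v}" "u \<noteq> v" "u < n" "v < n"
      using edge by (auto simp: nsets_2_eq)
    then have "D e = {1..r} - agree r (f u) (f v)"
      by (auto simp: D_def agree_def)
    moreover have "agree r (f u) (f v) \<subseteq> {1..r}"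
      by (auto simp: agree_def)
    ultimately have "card (D e) = r - card (agree r (f u) (f v))"
      by (simp add: card_Diff_subset finite_subset[of _ "{Suc 0..r}"])
    then have "s \<le> card (D e)"
      using sep e assms(1) by force
    then obtain A where "A \<subseteq> D e" "card A = s" "finite A"
      by (rule obtain_subset_with_card_n)
    moreover have "D e \<subseteq> {1..r}"
      by (auto simp: D_def)
    ultimately show ?thesis
      by (auto simp: nsets_def)
  qed
  then obtain c where c: "\<And>e. e \<in> nsets {..<n} 2 \<Longrightarrow> c e \<in> nsets {1..r} s \<and> c e \<subseteq> D e"
    by metis
  have "\<not> has_mono_clique r k n c"
  proof
    assume "has_mono_clique r k n c"
    then obtain S i where S: "S \<subseteq> {..<n}" "card S = k" and i: "i \<in> {1..r}"
      and mono: "\<forall>e \<in> nsets S 2. i \<in> c e"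
      by (auto simp: has_mono_clique_def nsets_def)
    \<comment> \<open>Colour \<open>i\<close> on an edge forces different \<open>i\<close>-th
      letters at its ends, so a clique in colour \<open>i\<close> embeds into the alphabet.\<close>
    have "inj_on (\<lambda>u. f u i) S"
    proof (rule inj_onI, rule ccontr)
      fix u v assume uv: "u \<in> S" "v \<in> S" "f u i = f v i" "u \<noteq> v"
      then have "{u, v} \<in> nsets S 2"
        by (auto simp: nsets_2_eq)
      moreover from this have "{u, v} \<in> nsets {..<n} 2"
        using S(1) nsets_mono by blast
      ultimately have "i \<in> D {u, v}"
        using c mono by blast
      then show False
        using uv by (auto simp: D_def)
    qed
    moreover have "(\<lambda>u. f u i) ` S \<subseteq> {..<q}"
      using words S(1) i by (fastforce simp: words_def PiE_iff)
    ultimately have "k \<le> q"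
      using S(2) card_inj_on_le[of "\<lambda>u. f u i" S "{..<q}"] by auto
    then show False
      using assms(2) by simp
  qed
  moreover have "set_colouring r s n c"
    using c by (auto simp: set_colouring_def)
  ultimately show ?thesis
    by blast
qed

theorem theorem4p1:
  fixes r s k :: nat and \<epsilon> :: real
  assumes "r > s" and "s \<ge> 1"
    and "\<epsilon> = (real r - real s) / real r"
    and "k \<ge> 1"
  shows "real (set_ramsey r s k) \<ge> (\<epsilon> * (real k - 1) / exp 1) powr (\<epsilon> * real r / 2)"
proof (rule ccontr)
  \<comment> \<open>With \<open>n\<close> the Ramsey number itself, one clique-free colouring on
    \<open>n\<close> vertices is already a contradiction.\<close>
  define n where "n = set_ramsey r s k"
  define q where "q = k - 1"
  \<comment> \<open>Fewer than \<open>j\<close> agreements means at most \<open>r - s\<close>, that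
    is, at least \<open>s\<close> differences.\<close>
  define j where "j = r - s + 1"
  define x where "x = \<epsilon> * (real k - 1) / exp 1"
  assume "\<not> ?thesis"
  then have n_less: "real n < x powr (\<epsilon> * real r / 2)"
    by (simp add: n_def x_def)
  have ramsey: "\<forall>c. set_colouring r s n c \<longrightarrow> has_mono_clique r k n c"
    unfolding n_def set_ramsey_def
    by (rule LeastI_ex) (rule set_ramsey_exists[OF assms(2)])
  have q: "real q = real k - 1"
    using assms(4) by (simp add: q_def)
  have eps: "\<epsilon> * real r = real (r - s)" "0 < \<epsilon>"
    using assms(1-3) by auto
  have x_nonneg: "0 \<le> x"
    using eps(2) by (simp add: x_def flip: q)
  have "\<exists>f. (\<forall>u<n. f u \<in> words q r) \<and>
            (\<forall>u<n. \<forall>v<n. u \<noteq> v \<longrightarrow> card (agree r (f u) (f v)) < j)"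
  proof (cases "n = 0")
    case False
    \<comment> \<open>If \<open>x \<le> 1\<close>, the bound is at most \<open>1\<close>, which
      forces \<open>n = 0\<close>.\<close>
    have x: "1 < x"
    proof (rule ccontr)
      assume "\<not> 1 < x"
      then have "x powr (\<epsilon> * real r / 2) \<le> 1"
        using x_nonneg eps by (intro powr_le1) auto
      then show False
        using n_less False by simp
    qed
    then have "0 < q"
      by (cases "q = 0") (auto simp: x_def simp flip: q)
    moreover have "\<forall>m<n. m * (r choose j) < q ^ j"
    proof (intro allI impI)
      fix m assume "m < n"
      then have "real m < x powr (\<epsilon> * real r / 2)"
        using n_less by linarith
      \<comment> \<open>The exponent on the left is \<open>(r - s) / 2\<close>, below
        \<open>j\<close>, and the base exceeds \<open>1\<close>.\<close>
      also have "\<dots> \<le> x powr real j"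
        using x eps by (intro powr_mono) (auto simp: j_def)
      also have "\<dots> = x ^ j"
        using x by (simp add: powr_realpow)
      also have "\<dots> \<le> (real j * real q / (exp 1 * real r)) ^ j"
      proof (intro power_mono x_nonneg)
        have "\<epsilon> \<le> real j / real r"
          using assms(1,3) by (auto simp: j_def field_simps)
        then have "\<epsilon> * real q / exp 1 \<le> real j / real r * real q / exp 1"
          by (intro divide_right_mono mult_right_mono) auto
        then show "x \<le> real j * real q / (exp 1 * real r)"
          by (simp add: x_def q mult.commute)
      qed
      finally have m: "real m < (real j * real q / (exp 1 * real r)) ^ j" .
      have pos: "0 < exp 1 * real r / real j"
        using assms(1) by (simp add: j_def)
      have "real (m * (r choose j)) \<le> real m * (exp 1 * real r / real j) ^ j"
        using binomial_le_exp_power[of j r] unfolding of_nat_mult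
        by (intro mult_left_mono) (auto simp: j_def)
      also have "\<dots> < (real j * real q / (exp 1 * real r)) ^ j * (exp 1 * real r / real j) ^ j"
        using m pos by (intro mult_strict_right_mono zero_less_power)
      \<comment> \<open>The two bases are chosen so that their product is exactly
        \<open>q\<close>.\<close>
      also have "\<dots> = real (q ^ j)"
        using assms(1) by (simp add: j_def flip: power_mult_distrib)
      finally show "m * (r choose j) < q ^ j"
        by linarith
    qed
    moreover have "j \<le> r"
      using assms(1,2) by (simp add: j_def)
    ultimately show ?thesis
      by (intro greedy_code)
  qed auto
  then obtain f where "\<forall>u<n. f u \<in> words q r"
    "\<forall>u<n. \<forall>v<n. u \<noteq> v \<longrightarrow> card (agree r (f u) (f v)) \<le> r - s"
    by (auto simp: j_def less_Suc_eq_le)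
  then obtain c where "set_colouring r s n c" "\<not> has_mono_clique r k n c"
    using colouring_of_code[of s r q k n f] assms(1,4) by (auto simp: q_def)
  with ramsey show False
    by blast
qed

end
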